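(* Let $\Delta$ be a finite set and let $\prec$ be a binary relation over $\Delta$. Then $\langle\Delta,\prec\rangle$ is a quasi-stratified order (i.e. $\langle\Delta,\prec\rangle\in\mathrm{QSO}$) if and only if the following two conditions hold for all $x,y,z,t\in\Delta$: (1) $x\not\prec x$; (2) if $x\prec y$ and $z\prec t$, then at least one of the following holds: ($x\prec t$ and $z\prec y$), or ($x\prec z$ and $x\prec t$), or ($z\prec x$ and $z\prec y$), or ($t\prec y$ and $z\prec y$), or ($y\prec t$ and $x\prec t$).
   Context: The set $\mathrm{QSO}$ of quasi-stratified orders is the smallest set of pairs $\langle\Delta,\prec\rangle$ (a set with a binary relation on it) such that $\langle\varnothing,\varnothing\rangle\in\mathrm{QSO}$ and, for all $q=\langle\Delta,\prec\rangle$ and $q'=\langle\Delta',\prec'\rangle$ in $\mathrm{QSO}$: (i) if $x\notin\Delta$, then $q[x]=\langle\Delta\cup\{x\},\prec\rangle\in\mathrm{QSO}$; (ii) if $\Delta\cap\Delta'=\varnothing$, then $q\circ q'=\langle\Delta\cup\Delta',\ \prec\cup\prec'\cup(\Delta\times\Delta')\rangle\in\mathrm{QSO}$. *)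

theory Defs imports Main
begin

definition add_isolated :: "'a set \<times> 'a rel \<Rightarrow> 'a \<Rightarrow> 'a set \<times> 'a rel" where
  "add_isolated q x = (fst q \<union> {x}, snd q)"

definition series_comp :: "'a set \<times> 'a rel \<Rightarrow> 'a set \<times> 'a rel \<Rightarrow> 'a set \<times> 'a rel" where
  "series_comp q q' = (fst q \<union> fst q', snd q \<union> snd q' \<union> fst q \<times> fst q')"

inductive_set QSO :: "('a set \<times> 'a rel) set" where
  empty: "({}, {}) \<in> QSO"
| isolated: "q \<in> QSO \<Longrightarrow> x \<notin> fst q \<Longrightarrow> add_isolated q x \<in> QSO"
| series: "q \<in> QSO \<Longrightarrow> q' \<in> QSO \<Longrightarrow> fst q \<inter> fst q' = {} \<Longrightarrow> series_comp q q' \<in> QSO"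

end

theory Submission imports Defs
begin

text \<open>Condition (2) passes to subsets and contains transitivity (take z = y). The
  converse direction is by induction on the size of the set. If some element is isolated, remove it.
  Otherwise let A be the set of the elements below every maximal element and B its complement.
  Maximal elements lie in B, and (2) puts every minimal element into A. If u is in A and v in B,
  then v is maximal, and u is below v; or v is not below some maximal t, and (2) applied to an edge
  from v and to the edge from u to t leaves only the alternative that u is below v. So the order
  is the series composition of its restrictions to A and B.\<close>

text \<open>Free of a carrier set, so that it applies unchanged to restrictions and to unions of
  relations; this loses nothing, since all edges of \<open>r\<close> lie within \<Delta>.\<close>

definition edge_cond :: "'a rel \<Rightarrow> bool" where
  "edge_cond r \<longleftrightarrow> (\<forall>x y z t. (x, y) \<in> r \<longrightarrow> (z, t) \<in> r \<longrightarrow>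
        ((x, t) \<in> r \<and> (z, y) \<in> r) \<or>
        ((x, z) \<in> r \<and> (x, t) \<in> r) \<or>
        ((z, x) \<in> r \<and> (z, y) \<in> r) \<or>
        ((t, y) \<in> r \<and> (z, y) \<in> r) \<or>
        ((y, t) \<in> r \<and> (x, t) \<in> r))"

lemma edge_condD:
  assumes "edge_cond r" "(x, y) \<in> r" "(z, t) \<in> r"
  shows "((x, t) \<in> r \<and> (z, y) \<in> r) \<or>
        ((x, z) \<in> r \<and> (x, t) \<in> r) \<or>
        ((z, x) \<in> r \<and> (z, y) \<in> r) \<or>
        ((t, y) \<in> r \<and> (z, y) \<in> r) \<or>
        ((y, t) \<in> r \<and> (x, t) \<in> r)"
  using assms unfolding edge_cond_def by simp

lemma edge_cond_trans:
  assumes "irrefl r" "edge_cond r"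
  shows "trans r"
proof (rule transI)
  fix x y z assume "(x, y) \<in> r" "(y, z) \<in> r"
  \<comment> \<open>Every alternative contains \<open>(x, z)\<close> or the loop
    \<open>(y, y)\<close>.\<close>
  with edge_condD[OF assms(2) this] assms(1) show "(x, z) \<in> r"
    unfolding irrefl_def by blast
qed

lemma edge_cond_restrict:
  assumes "edge_cond r"
  shows "edge_cond (r \<inter> A \<times> A)"
  unfolding edge_cond_def
proof (intro allI impI)
  fix x y z t
  let ?q = "r \<inter> A \<times> A"
  assume "(x, y) \<in> ?q" "(z, t) \<in> ?q"
  then have "(x, y) \<in> r" "(z, t) \<in> r" and "x \<in> A" "y \<in> A" "z \<in> A" "t \<in> A" by auto
  with edge_condD[OF assms this(1,2)]
  show "((x, t) \<in> ?q \<and> (z, y) \<in> ?q) \<or>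
    ((x, z) \<in> ?q \<and> (x, t) \<in> ?q) \<or>
    ((z, x) \<in> ?q \<and> (z, y) \<in> ?q) \<or>
    ((t, y) \<in> ?q \<and> (z, y) \<in> ?q) \<or>
    ((y, t) \<in> ?q \<and> (x, t) \<in> ?q)" by simp
qed

lemma irrefl_restrict: "irrefl r \<Longrightarrow> irrefl (r \<inter> A \<times> A)"
  unfolding irrefl_def by blast

lemma edge_cond_series:
  assumes r: "r \<subseteq> A \<times> A" "edge_cond r" and s: "s \<subseteq> B \<times> B" "edge_cond s"
  shows "edge_cond (r \<union> s \<union> A \<times> B)"
  unfolding edge_cond_def
proof (intro allI impI)
  fix x y z t
  let ?q = "r \<union> s \<union> A \<times> B"
  assume xy: "(x, y) \<in> ?q" and zt: "(z, t) \<in> ?q"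
  \<comment> \<open>Unless both edges come from \<open>r\<close> or both from \<open>s\<close>, the
    positions of the endpoints settle the claim through pairs in \<open>A \<times> B\<close>. The
    last five cases give the first, second, third, fifth and fourth alternative, in this
    order.\<close>
  consider "(x, y) \<in> r" "(z, t) \<in> r" | "(x, y) \<in> s" "(z, t) \<in> s"
    | "x \<in> A" "t \<in> B" "z \<in> A" "y \<in> B"
    | "x \<in> A" "z \<in> B" "t \<in> B" | "z \<in> A" "x \<in> B" "y \<in> B"
    | "x \<in> A" "y \<in> A" "t \<in> B" | "z \<in> A" "t \<in> A" "y \<in> B"
    using xy zt r(1) s(1) by blast
  then show "((x, t) \<in> ?q \<and> (z, y) \<in> ?q) \<or>
    ((x, z) \<in> ?q \<and> (x, t) \<in> ?q) \<or>
    ((z, x) \<in> ?q \<and> (z, y) \<in> ?q) \<or>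
    ((t, y) \<in> ?q \<and> (z, y) \<in> ?q) \<or>
    ((y, t) \<in> ?q \<and> (x, t) \<in> ?q)"
  proof cases
    case 1
    from edge_condD[OF r(2) this] show ?thesis by (elim disjE conjE) simp_all
  next
    case 2
    from edge_condD[OF s(2) this] show ?thesis by (elim disjE conjE) simp_all
  qed simp_all
qed

text \<open>Containment in the carrier is carried through the induction because the series case
  relies on it, both for \<open>edge_cond_series\<close> and, with disjointness, for
  irreflexivity.\<close>

lemma QSO_imp_edge_cond:
  assumes "q \<in> QSO"
  shows "snd q \<subseteq> fst q \<times> fst q \<and> irrefl (snd q) \<and> edge_cond (snd q)"
  using assms
proof induction
  case empty
  show ?case by (simp add: irrefl_def edge_cond_def)
next
  case (isolated q x)
  then show ?case by (auto simp: add_isolated_def)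
next
  case (series q q')
  then have "edge_cond (snd q \<union> snd q' \<union> fst q \<times> fst q')"
    using edge_cond_series by metis
  with series show ?case by (auto simp: series_comp_def irrefl_def)
qed

text \<open>This is the induction step without isolated elements: as both parts are nonempty, each
  is a proper subset of \<Delta>.\<close>

lemma edge_cond_series_decomposition:
  assumes fin: "finite \<Delta>" and ne: "\<Delta> \<noteq> {}" and sub: "r \<subseteq> \<Delta> \<times> \<Delta>"
    and irr: "irrefl r" and ec: "edge_cond r" and no_isolated: "\<Delta> \<subseteq> Field r"
  obtains A B where "A \<noteq> {}" "B \<noteq> {}" "A \<inter> B = {}" "A \<union> B = \<Delta>" "A \<times> B \<subseteq> r"
proof -
  have tr: "trans r" using irr ec by (rule edge_cond_trans)
  have ac: "acyclic r" using irr tr by (simp add: acyclic_def irrefl_def)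
  have fr: "finite r" using finite_subset[OF sub] fin by simp
  obtain c where c: "c \<in> \<Delta>" using ne by blast
  obtain a where a: "a \<in> \<Delta>" "\<And>w. (w, a) \<in> r \<Longrightarrow> w \<notin> \<Delta>"
    using wfE_min[OF finite_acyclic_wf[OF fr ac] c] by metis
  obtain b where b: "b \<in> \<Delta>" "\<And>w. (w, b) \<in> r\<inverse> \<Longrightarrow> w \<notin> \<Delta>"
    using wfE_min[OF finite_acyclic_wf_converse[OF fr ac] c] by metis
  have a_min: "(w, a) \<notin> r" for w using a(2)[of w] sub by blast
  have b_max: "(b, w) \<notin> r" for w using b(2)[of w] sub by blast
  define A where "A = {u \<in> \<Delta>. \<forall>t\<in>\<Delta>. (\<forall>w. (t, w) \<notin> r) \<longrightarrow> (u, t) \<in> r}"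
  have "a \<in> A"
  proof -
    have "(a, t) \<in> r" if t: "t \<in> \<Delta>" "\<forall>w. (t, w) \<notin> r" for t
    proof -
      \<comment> \<open>The minimal \<open>a\<close> is not isolated, so an edge leaves it; likewise
        an edge enters the maximal \<open>t\<close>. For these two edges, every alternative contains
        \<open>(a, t)\<close>, an edge into \<open>a\<close> or an edge out of
        \<open>t\<close>.\<close>
      obtain y where "(a, y) \<in> r" using no_isolated a(1) a_min by (auto simp: Field_def)
      moreover obtain z where "(z, t) \<in> r" using no_isolated t by (auto simp: Field_def)
      ultimately show ?thesis using edge_condD[OF ec] a_min t(2) by blast
    qed
    then show ?thesis using a(1) by (simp add: A_def)
  qed
  \<comment> \<open>As \<open>b\<close> is itself maximal, membership in \<open>A\<close> would
    require the loop \<open>(b, b)\<close>.\<close>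
  moreover have "b \<in> \<Delta> - A" using b(1) b_max by (auto simp: A_def)
  moreover have "A \<times> (\<Delta> - A) \<subseteq> r"
  proof clarify
    fix u v assume u: "u \<in> A" and v: "v \<in> \<Delta>" "v \<notin> A"
    show "(u, v) \<in> r"
    proof (cases "\<forall>w. (v, w) \<notin> r")
      case True
      then show ?thesis using u v(1) by (simp add: A_def)
    next
      case False
      then obtain w where vw: "(v, w) \<in> r" by blast
      obtain t where t: "t \<in> \<Delta>" "\<forall>w. (t, w) \<notin> r" "(v, t) \<notin> r"
        using v by (auto simp: A_def)
      have "(u, t) \<in> r" using u t by (simp add: A_def)
      \<comment> \<open>The first, third and fourth alternatives contain \<open>(v, t)\<close>, and
        the fifth needs an edge out of \<open>t\<close>.\<close>
      from edge_condD[OF ec this vw] show ?thesis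
        using t transD[OF tr vw] by blast
    qed
  qed
  moreover have "A \<union> (\<Delta> - A) = \<Delta>" by (auto simp: A_def)
  ultimately show ?thesis using that[of A "\<Delta> - A"] by blast
qed

lemma edge_cond_imp_QSO:
  assumes "finite \<Delta>" "r \<subseteq> \<Delta> \<times> \<Delta>" "irrefl r" "edge_cond r"
  shows "(\<Delta>, r) \<in> QSO"
  using assms
proof (induction \<Delta> arbitrary: r rule: finite_psubset_induct)
  case (psubset \<Delta>)
  note sub = psubset.prems(1) and irr = psubset.prems(2) and ec = psubset.prems(3)
  consider "\<Delta> = {}" | x where "x \<in> \<Delta>" "x \<notin> Field r" | "\<Delta> \<noteq> {}" "\<Delta> \<subseteq> Field r"
    by blast
  then show ?case
  proof cases
    case 1
    with sub show ?thesis using QSO.empty by simp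
  next
    case 2
    \<comment> \<open>No edge touches \<open>x\<close>, so removing it leaves the relation as it
      is.\<close>
    then have "r \<subseteq> (\<Delta> - {x}) \<times> (\<Delta> - {x})" using sub by (auto simp: Field_def)
    then have "(\<Delta> - {x}, r) \<in> QSO" using psubset.IH[of "\<Delta> - {x}" r] 2 irr ec by blast
    from QSO.isolated[OF this, of x] 2 show ?thesis
      by (simp add: add_isolated_def insert_absorb)
  next
    case 3
    obtain A B where AB: "A \<noteq> {}" "B \<noteq> {}" "A \<inter> B = {}" "A \<union> B = \<Delta>" "A \<times> B \<subseteq> r"
      using edge_cond_series_decomposition[OF psubset.hyps(1) 3(1) sub irr ec 3(2)] by metis
    have "(A, r \<inter> A \<times> A) \<in> QSO"
      using AB by (intro psubset.IH edge_cond_restrict irrefl_restrict irr ec) auto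
    moreover have "(B, r \<inter> B \<times> B) \<in> QSO"
      using AB by (intro psubset.IH edge_cond_restrict irrefl_restrict irr ec) auto
    ultimately have "series_comp (A, r \<inter> A \<times> A) (B, r \<inter> B \<times> B) \<in> QSO"
      by (rule QSO.series) (simp add: AB(3))
    \<comment> \<open>An edge back from \<open>B\<close> to \<open>A\<close> would, by transitivity
      with \<open>(x, y)\<close>, give a loop. Hence \<open>r\<close> has no edges beyond those of
      the series composition.\<close>
    moreover have "(y, x) \<notin> r" if "x \<in> A" "y \<in> B" for x y
      using that AB(5) irr edge_cond_trans[OF irr ec] unfolding irrefl_def trans_def by blast
    then have "r = r \<inter> A \<times> A \<union> r \<inter> B \<times> B \<union> A \<times> B"
      using sub AB(4,5) by blast
    ultimately show ?thesis using AB(4) by (simp add: series_comp_def)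
  qed
qed

theorem theorem3p3:
  fixes \<Delta> :: "'a set" and r :: "'a rel"
  assumes "finite \<Delta>" and "r \<subseteq> \<Delta> \<times> \<Delta>"
  shows "(\<Delta>, r) \<in> QSO \<longleftrightarrow>
    (\<forall>x\<in>\<Delta>. \<forall>y\<in>\<Delta>. \<forall>z\<in>\<Delta>. \<forall>t\<in>\<Delta>.
      (x, x) \<notin> r \<and>
      ((x, y) \<in> r \<and> (z, t) \<in> r \<longrightarrow>
        ((x, t) \<in> r \<and> (z, y) \<in> r) \<or>
        ((x, z) \<in> r \<and> (x, t) \<in> r) \<or>
        ((z, x) \<in> r \<and> (z, y) \<in> r) \<or>
        ((t, y) \<in> r \<and> (z, y) \<in> r) \<or>
        ((y, t) \<in> r \<and> (x, t) \<in> r)))" (is "_ \<longleftrightarrow> ?C")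
proof
  assume "(\<Delta>, r) \<in> QSO"
  then have "irrefl r" "edge_cond r" using QSO_imp_edge_cond by fastforce+
  then show ?C unfolding irrefl_def edge_cond_def by simp
next
  assume C: ?C
  then have "irrefl r" unfolding irrefl_def using assms(2) by blast
  moreover have "edge_cond r"
    unfolding edge_cond_def
  proof (intro allI impI)
    fix x y z t assume *: "(x, y) \<in> r" "(z, t) \<in> r"
    then have "x \<in> \<Delta>" "y \<in> \<Delta>" "z \<in> \<Delta>" "t \<in> \<Delta>" using assms(2) by auto
    from C[rule_format, OF this] *
    show "((x, t) \<in> r \<and> (z, y) \<in> r) \<or>
        ((x, z) \<in> r \<and> (x, t) \<in> r) \<or>
        ((z, x) \<in> r \<and> (z, y) \<in> r) \<or>
        ((t, y) \<in> r \<and> (z, y) \<in> r) \<or>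
        ((y, t) \<in> r \<and> (x, t) \<in> r)" by blast
  qed
  ultimately show "(\<Delta>, r) \<in> QSO" using edge_cond_imp_QSO assms by blast
qed

end
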